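(* Consider the scheme described in the context, with stabilisation terms $q^{n+1}_{i,j}=\eta\Delta t(\eth_x\phi^{n+1}_{i,j}-\omega v^n_{i,j})$ and $r^{n+1}_{i,j}=\eta\Delta t(\eth_y\phi^{n+1}_{i,j}+\omega u^n_{i,j})$, $\eta>0$. Suppose that the solution $(h^n_{i,j},u^n_{i,j},v^n_{i,j})$ at time $t^n$ satisfies, for each $(i,j)$, $$u^n_{i,j}=0,\quad \eth_yh^n_{i,j}=0,\quad \eth_yb_{i,j}=0,\quad \eth_yv^n_{i,j}=0,\quad \eth_x\phi^n_{i,j}-\omega v^n_{i,j}=0.$$ Then, under the time-step restriction that for all $(i,j)$ $$\Delta t\Bigl(\frac2{\Delta x}+\frac2{\Delta y}\Bigr)\Bigl(\max\{|u^n_{i,j}|,|u^n_{i+1,j}|\}+\sqrt{\tfrac{\eta}{\max\{h^{n+1}_{i,j},h^{n+1}_{i+1,j}\}}}\;\Lambda^{n+1}_{i+\frac12,j}\Bigr)<\min\Bigl\{1,\frac{\min\{h^n_{i,j},h^n_{i+1,j}\}}{\max\{h^{n+1}_{i,j},h^{n+1}_{i+1,j}\}}\Bigr\},$$ $$\Delta t\Bigl(\frac2{\Delta x}+\frac2{\Delta y}\Bigr)\Bigl(\max\{|v^n_{i,j}|,|v^n_{i,j+1}|\}+\sqrt{\tfrac{\eta}{\max\{h^{n+1}_{i,j},h^{n+1}_{i,j+1}\}}}\;\Lambda^{n+1}_{i,j+\frac12}\Bigr)<\min\Bigl\{1,\frac{\min\{h^n_{i,j},h^n_{i,j+1}\}}{\max\{h^{n+1}_{i,j},h^{n+1}_{i,j+1}\}}\Bigr\},$$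 the updated solution at time $t^{n+1}$ satisfies, for each $(i,j)$, $(h^{n+1}_{i,j},u^{n+1}_{i,j},v^{n+1}_{i,j})=(h^n_{i,j},u^n_{i,j},v^n_{i,j})$ and $$u^{n+1}_{i,j}=0,\quad \eth_yh^{n+1}_{i,j}=0,\quad \eth_yv^{n+1}_{i,j}=0,\quad \eth_x\phi^{n+1}_{i,j}-\omega v^{n+1}_{i,j}=0.$$ Analogously, if instead for each $(i,j)$ $$v^n_{i,j}=0,\quad \eth_xh^n_{i,j}=0,\quad \eth_xb_{i,j}=0,\quad \eth_xu^n_{i,j}=0,\quad \eth_y\phi^n_{i,j}+\omega u^n_{i,j}=0,$$ then under the same time-step restriction $(h^{n+1}_{i,j},u^{n+1}_{i,j},v^{n+1}_{i,j})=(h^n_{i,j},u^n_{i,j},v^n_{i,j})$ and $v^{n+1}_{i,j}=0$, $\eth_xh^{n+1}_{i,j}=0$, $\eth_xu^{n+1}_{i,j}=0$, $\eth_y\phi^{n+1}_{i,j}+\omega u^{n+1}_{i,j}=0$ for each $(i,j)$.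
   Context: **Setting.** $\Omega$ is the two-dimensional torus, partitioned (periodic boundary conditions) into a uniform rectangular mesh of cells $K_{i,j}=[x_{i-\frac12},x_{i+\frac12}]\times[y_{j-\frac12},y_{j+\frac12}]$ with constant space steps $\Delta x,\Delta y>0$; the indices $(i,j)$ are periodic. The mesh size $\delta_{\mathcal T}=\max_{i,j}\operatorname{diam}(K_{i,j})$ is supposed to lie in $(0,\delta_0]$ for a sufficiently small $\delta_0$. $T>0$, and $0=t^0<\dots<t^N=T$ has constant step $\Delta t$. $g>0$ is the gravitational acceleration, $\omega\in\mathbb R$ is the Coriolis parameter, $b\in W^{2,\infty}(\Omega)$ is the bottom topography with cell averages $b_{i,j}=\frac1{\Delta x\Delta y}\int_{K_{i,j}}b$. **Notation.** For a grid function $z=(z_{i,j})$: $\{\{z\}\}_{i+\frac12,j}=\frac12(z_{i,j}+z_{i+1,j})$, $\{\{z\}\}_{i,j+\frac12}=\frac12(z_{i,j}+z_{i,j+1})$; $\eth_xz_{i,j}=\frac{1}{\Delta x}(\{\{z\}\}_{i+\frac12,j}-\{\{z\}\}_{i-\frac12,j})$, $\eth_yz_{i,j}=\frac{1}{\Delta y}(\{\{z\}\}_{i,j+\frac12}-\{\{z\}\}_{i,j-\frac12})$. **Scheme.** For $0\le n\le N-1$: $$\frac{h^{n+1}_{i,j}-h^n_{i,j}}{\Delta t}+\frac{F^{n+1}_{i+\frac12,j}-F^{n+1}_{i-\frac12,j}}{\Delta x}+\frac{G^{n+1}_{i,j+\frac12}-G^{n+1}_{i,j-\frac12}}{\Delta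 y}=0,$$ $$\frac{h^{n+1}_{i,j}u^{n+1}_{i,j}-h^n_{i,j}u^n_{i,j}}{\Delta t}+\frac{F^{n+1}_{i+\frac12,j}u^n_{i+\frac12,j}-F^{n+1}_{i-\frac12,j}u^n_{i-\frac12,j}}{\Delta x}+\frac{G^{n+1}_{i,j+\frac12}u^n_{i,j+\frac12}-G^{n+1}_{i,j-\frac12}u^n_{i,j-\frac12}}{\Delta y}+h^{n+1}_{i,j}\eth_x\phi^{n+1}_{i,j}=\omega h^{n+1}_{i,j}v^n_{i,j}-\omega r^{n+1}_{i,j},$$ $$\frac{h^{n+1}_{i,j}v^{n+1}_{i,j}-h^n_{i,j}v^n_{i,j}}{\Delta t}+\frac{F^{n+1}_{i+\frac12,j}v^n_{i+\frac12,j}-F^{n+1}_{i-\frac12,j}v^n_{i-\frac12,j}}{\Delta x}+\frac{G^{n+1}_{i,j+\frac12}v^n_{i,j+\frac12}-G^{n+1}_{i,j-\frac12}v^n_{i,j-\frac12}}{\Delta y}+h^{n+1}_{i,j}\eth_y\phi^{n+1}_{i,j}=-\omega h^{n+1}_{i,j}u^n_{i,j}+\omega q^{n+1}_{i,j}.$$ Here $\phi^{n}_{i,j}=g(h^{n}_{i,j}+b_{i,j})$, the fluxes are $$F^{n+1}_{i+\frac12,j}=\{\{h^{n+1}u^n\}\}_{i+\frac12,j}-\{\{q^{n+1}\}\}_{i+\frac12,j},\qquad G^{n+1}_{i,j+\frac12}=\{\{h^{n+1}v^n\}\}_{i,j+\frac12}-\{\{r^{n+1}\}\}_{i,j+\frac12},$$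 and the edge velocities are upwind: for $w=u,v$, $w^n_{i+\frac12,j}=w^n_{i,j}$ if $F^{n+1}_{i+\frac12,j}\ge0$ and $w^n_{i+1,j}$ otherwise; $w^n_{i,j+\frac12}=w^n_{i,j}$ if $G^{n+1}_{i,j+\frac12}\ge0$ and $w^n_{i,j+1}$ otherwise. **Quantities in the time-step restriction.** $$\Lambda^{n+1}_{i+\frac12,j}=\sqrt{\max\{|\eth_x\phi^{n+1}_{i,j}-\omega v^n_{i,j}|,\,|\eth_x\phi^{n+1}_{i+1,j}-\omega v^n_{i+1,j}|\}},\qquad \Lambda^{n+1}_{i,j+\frac12}=\sqrt{\max\{|\eth_y\phi^{n+1}_{i,j}+\omega u^n_{i,j}|,\,|\eth_y\phi^{n+1}_{i,j+1}+\omega u^n_{i,j+1}|\}}.$$ The restriction is implicit: the $h^{n+1}$ and $\phi^{n+1}$ occurring in it are those of the updated solution.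
   Formalization: The formal theorem also assumes that, if the number of cells in y (resp. x for the analogue) is even, v^n (resp. u^n) is constant in that direction; ð_y v=0 alone allows alternating v, for which the claim fails. *)

theory Defs
  imports "HOL-Analysis.Analysis"
begin

section \<open>The Sobolev space \<open>W\<^sup>k\<^sup>,\<^sup>\<infinity>\<close> of a two-dimensional torus\<close>

text \<open>
  A function on the torus with periods \<open>lx\<close> and \<open>ly\<close> is a function on the plane with these periods;
  it is integrated over one period rectangle.  The torus has no boundary, so all smooth periodic
  functions are test functions.
\<close>

definition on_torus :: "real \<Rightarrow> real \<Rightarrow> (real \<times> real \<Rightarrow> real) \<Rightarrow> bool" where
  "on_torus lx ly f \<longleftrightarrow> (\<forall>x y. f (x + lx, y) = f (x, y) \<and> f (x, y + ly) = f (x, y))"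

definition torus_integral :: "real \<Rightarrow> real \<Rightarrow> (real \<times> real \<Rightarrow> real) \<Rightarrow> real" where
  "torus_integral lx ly f = (LINT z : {0..lx} \<times> {0..ly} | lebesgue. f z)"

fun Ck :: "nat \<Rightarrow> (real \<times> real \<Rightarrow> real) \<Rightarrow> bool" where
  "Ck 0 f \<longleftrightarrow> continuous_on UNIV f"
| "Ck (Suc k) f \<longleftrightarrow>
     (\<exists>f1 f2. (\<forall>z. (f has_derivative (\<lambda>(a, c). a * f1 z + c * f2 z)) (at z)) \<and> Ck k f1 \<and> Ck k f2)"

definition smooth_fun :: "(real \<times> real \<Rightarrow> real) \<Rightarrow> bool" where
  "smooth_fun f \<longleftrightarrow> (\<forall>k. Ck k f)"

definition pd_x :: "(real \<times> real \<Rightarrow> real) \<Rightarrow> real \<times> real \<Rightarrow> real" where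
  "pd_x f = (\<lambda>(x, y). deriv (\<lambda>s. f (s, y)) x)"

definition pd_y :: "(real \<times> real \<Rightarrow> real) \<Rightarrow> real \<times> real \<Rightarrow> real" where
  "pd_y f = (\<lambda>(x, y). deriv (\<lambda>s. f (x, s)) y)"

definition Linf_torus :: "real \<Rightarrow> real \<Rightarrow> (real \<times> real \<Rightarrow> real) \<Rightarrow> bool" where
  "Linf_torus lx ly f \<longleftrightarrow>
     on_torus lx ly f \<and> f \<in> borel_measurable lebesgue \<and> (\<exists>C. AE z in lebesgue. \<bar>f z\<bar> \<le> C)"

definition weak_deriv ::
  "real \<Rightarrow> real \<Rightarrow> nat \<Rightarrow> nat \<Rightarrow> (real \<times> real \<Rightarrow> real) \<Rightarrow> (real \<times> real \<Rightarrow> real) \<Rightarrow> bool" where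
  "weak_deriv lx ly k l f d \<longleftrightarrow>
     (\<forall>\<psi>. smooth_fun \<psi> \<and> on_torus lx ly \<psi> \<longrightarrow>
        torus_integral lx ly (\<lambda>z. f z * (pd_x ^^ k) ((pd_y ^^ l) \<psi>) z) =
        (-1) ^ (k + l) * torus_integral lx ly (\<lambda>z. d z * \<psi> z))"

definition Wkinf_torus :: "nat \<Rightarrow> real \<Rightarrow> real \<Rightarrow> (real \<times> real \<Rightarrow> real) \<Rightarrow> bool" where
  "Wkinf_torus m lx ly f \<longleftrightarrow>
     Linf_torus lx ly f \<and>
     (\<forall>k l. k + l \<le> m \<longrightarrow> (\<exists>d. Linf_torus lx ly d \<and> weak_deriv lx ly k l f d))"


section \<open>Mesh and discrete operators\<close>

record swe =
  nx :: nat
  ny :: nat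
  dx :: real
  dy :: real
  dt :: real
  grav :: real
  coriolis :: real
  topo :: "real \<times> real \<Rightarrow> real"

text \<open>
  Grid functions are indexed by all pairs of integers and are periodic with the numbers of cells
  \<open>nx\<close> and \<open>ny\<close>.  Cell 0 begins at the origin, so \<open>x\<^bsub>i-1/2\<^esub> = i * dx\<close>.  A quantity attached to
  the edge \<open>(i+1/2, j)\<close> or \<open>(i, j+1/2)\<close> is stored at the index \<open>(i, j)\<close>.
\<close>

type_synonym grid = "int \<Rightarrow> int \<Rightarrow> real"

definition periodic_grid :: "swe \<Rightarrow> grid \<Rightarrow> bool" where
  "periodic_grid p z \<longleftrightarrow>
     (\<forall>i j. z (i + int (nx p)) j = z i j \<and> z i (j + int (ny p)) = z i j)"

definition cell :: "swe \<Rightarrow> int \<Rightarrow> int \<Rightarrow> (real \<times> real) set" where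
  "cell p i j = {of_int i * dx p .. (of_int i + 1) * dx p} \<times> {of_int j * dy p .. (of_int j + 1) * dy p}"

definition mesh_size :: "swe \<Rightarrow> real" where
  "mesh_size p = (MAX (i, j) \<in> {0..<int (nx p)} \<times> {0..<int (ny p)}. diameter (cell p i j))"

definition topo_avg :: "swe \<Rightarrow> grid" where
  "topo_avg p i j = 1 / (dx p * dy p) * (LINT z : cell p i j | lebesgue. topo p z)"

definition avg_x :: "grid \<Rightarrow> grid" where
  "avg_x z i j = (z i j + z (i + 1) j) / 2"

definition avg_y :: "grid \<Rightarrow> grid" where
  "avg_y z i j = (z i j + z i (j + 1)) / 2"

definition eth_x :: "swe \<Rightarrow> grid \<Rightarrow> grid" where
  "eth_x p z i j = (avg_x z i j - avg_x z (i - 1) j) / dx p"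

definition eth_y :: "swe \<Rightarrow> grid \<Rightarrow> grid" where
  "eth_y p z i j = (avg_y z i j - avg_y z i (j - 1)) / dy p"

definition phi :: "swe \<Rightarrow> grid \<Rightarrow> grid" where
  "phi p h i j = grav p * (h i j + topo_avg p i j)"


section \<open>The scheme\<close>

text \<open>
  Suffix 0 marks a quantity at the old time level and suffix 1 one at the new time level.
\<close>

definition flux_x :: "grid \<Rightarrow> grid \<Rightarrow> grid \<Rightarrow> grid" where
  "flux_x h1 u0 q1 i j = avg_x (\<lambda>i j. h1 i j * u0 i j) i j - avg_x q1 i j"

definition flux_y :: "grid \<Rightarrow> grid \<Rightarrow> grid \<Rightarrow> grid" where
  "flux_y h1 v0 r1 i j = avg_y (\<lambda>i j. h1 i j * v0 i j) i j - avg_y r1 i j"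

definition upwind_x :: "grid \<Rightarrow> grid \<Rightarrow> grid" where
  "upwind_x F w i j = (if F i j \<ge> 0 then w i j else w (i + 1) j)"

definition upwind_y :: "grid \<Rightarrow> grid \<Rightarrow> grid" where
  "upwind_y G w i j = (if G i j \<ge> 0 then w i j else w i (j + 1))"

definition upwind_div :: "swe \<Rightarrow> grid \<Rightarrow> grid \<Rightarrow> grid \<Rightarrow> grid" where
  "upwind_div p F G w i j =
     (F i j * upwind_x F w i j - F (i - 1) j * upwind_x F w (i - 1) j) / dx p +
     (G i j * upwind_y G w i j - G i (j - 1) * upwind_y G w i (j - 1)) / dy p"

definition scheme_step ::
  "swe \<Rightarrow> grid \<Rightarrow> grid \<Rightarrow> grid \<Rightarrow> grid \<Rightarrow> grid \<Rightarrow> grid \<Rightarrow> grid \<Rightarrow> grid \<Rightarrow> bool" where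
  "scheme_step p q1 r1 h0 u0 v0 h1 u1 v1 \<longleftrightarrow>
     (let F = flux_x h1 u0 q1; G = flux_y h1 v0 r1 in
      \<forall>i j.
        (h1 i j - h0 i j) / dt p
          + (F i j - F (i - 1) j) / dx p + (G i j - G i (j - 1)) / dy p = 0 \<and>
        (h1 i j * u1 i j - h0 i j * u0 i j) / dt p + upwind_div p F G u0 i j
          + h1 i j * eth_x p (phi p h1) i j
          = coriolis p * h1 i j * v0 i j - coriolis p * r1 i j \<and>
        (h1 i j * v1 i j - h0 i j * v0 i j) / dt p + upwind_div p F G v0 i j
          + h1 i j * eth_y p (phi p h1) i j
          = - coriolis p * h1 i j * u0 i j + coriolis p * q1 i j)"

definition stab_q :: "swe \<Rightarrow> real \<Rightarrow> grid \<Rightarrow> grid \<Rightarrow> grid" where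
  "stab_q p \<eta> h1 v0 i j = \<eta> * dt p * (eth_x p (phi p h1) i j - coriolis p * v0 i j)"

definition stab_r :: "swe \<Rightarrow> real \<Rightarrow> grid \<Rightarrow> grid \<Rightarrow> grid" where
  "stab_r p \<eta> h1 u0 i j = \<eta> * dt p * (eth_y p (phi p h1) i j + coriolis p * u0 i j)"


section \<open>The time-step restriction\<close>

definition Lambda_x :: "swe \<Rightarrow> grid \<Rightarrow> grid \<Rightarrow> grid" where
  "Lambda_x p h1 v0 i j =
     sqrt (max \<bar>eth_x p (phi p h1) i j - coriolis p * v0 i j\<bar>
               \<bar>eth_x p (phi p h1) (i + 1) j - coriolis p * v0 (i + 1) j\<bar>)"

definition Lambda_y :: "swe \<Rightarrow> grid \<Rightarrow> grid \<Rightarrow> grid" where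
  "Lambda_y p h1 u0 i j =
     sqrt (max \<bar>eth_y p (phi p h1) i j + coriolis p * u0 i j\<bar>
               \<bar>eth_y p (phi p h1) i (j + 1) + coriolis p * u0 i (j + 1)\<bar>)"

text \<open>
  The positivity conjuncts say precisely that the quotients and square roots are defined in the
  mathematical sense (HOL gives \<open>x / 0\<close> and \<open>sqrt\<close> of a negative number junk values).  With them
  the restriction forces the old water height to be positive everywhere.
\<close>

definition time_step_restriction :: "swe \<Rightarrow> real \<Rightarrow> grid \<Rightarrow> grid \<Rightarrow> grid \<Rightarrow> grid \<Rightarrow> bool" where
  "time_step_restriction p \<eta> h0 u0 v0 h1 \<longleftrightarrow>
     (\<forall>i j.
        0 < max (h1 i j) (h1 (i + 1) j) \<and>
        dt p * (2 / dx p + 2 / dy p) *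
          (max \<bar>u0 i j\<bar> \<bar>u0 (i + 1) j\<bar>
            + sqrt (\<eta> / max (h1 i j) (h1 (i + 1) j)) * Lambda_x p h1 v0 i j)
          < min 1 (min (h0 i j) (h0 (i + 1) j) / max (h1 i j) (h1 (i + 1) j)) \<and>
        0 < max (h1 i j) (h1 i (j + 1)) \<and>
        dt p * (2 / dx p + 2 / dy p) *
          (max \<bar>v0 i j\<bar> \<bar>v0 i (j + 1)\<bar>
            + sqrt (\<eta> / max (h1 i j) (h1 i (j + 1))) * Lambda_y p h1 u0 i j)
          < min 1 (min (h0 i j) (h0 i (j + 1)) / max (h1 i j) (h1 i (j + 1))))"


section \<open>Absence of checkerboard modes\<close>

text \<open>
  \<open>eth_y p z = 0\<close> only says \<open>z i (j + 1) = z i (j - 1)\<close>.  If \<open>ny\<close> is odd, periodicity makes \<open>z\<close>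
  constant in \<open>j\<close> and the predicate below is void; if \<open>ny\<close> is even, \<open>z\<close> may still alternate in \<open>j\<close>.
  An alternating velocity component is not preserved by the upwind transport term, although the
  centred differences see it as constant: take \<open>nx = 4\<close>, \<open>ny = 2\<close>, \<open>dx = dy = grav = coriolis = \<eta> = 1\<close>,
  \<open>dt = 1/100\<close>, \<open>topo = 0\<close>, \<open>u = 0\<close>, \<open>h i 0 = 4 + f i\<close>, \<open>h i 1 = 4 - f i\<close> with \<open>f = 0, 1, 1, 0\<close>, and
  \<open>v = eth_x h\<close>.  Then all steady-state equations and the restriction hold with unchanged \<open>h\<close>, but
  \<open>v 1 0 = 1/2\<close> is updated to \<open>499/1000\<close>.
\<close>

definition no_checkerboard_x :: "swe \<Rightarrow> grid \<Rightarrow> bool" where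
  "no_checkerboard_x p z \<longleftrightarrow> (even (nx p) \<longrightarrow> (\<forall>i j. z (i + 1) j = z i j))"

definition no_checkerboard_y :: "swe \<Rightarrow> grid \<Rightarrow> bool" where
  "no_checkerboard_y p z \<longleftrightarrow> (even (ny p) \<longrightarrow> (\<forall>i j. z i (j + 1) = z i j))"

end

theory Submission
  imports Defs
begin

text \<open>
  Write \<open>d = h\<^sup>n\<^sup>+\<^sup>1 - h\<^sup>n\<close>.  The old state is in discrete geostrophic equilibrium, so the stabilisation
  terms measure only the change of the height: they are \<open>\<eta> dt grav\<close> times the centred differences
  \<open>eth_x d\<close> and \<open>eth_y d\<close>.  Each velocity component is moreover constant along its own direction, and
  the centred difference of the old height along the flow vanishes.  The continuity equation therefore becomes a linear
  equation for \<open>d\<close> alone,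
  \<open>d + dt (u eth_x d + v eth_y d) = \<eta> grav dt\<^sup>2 (eth_x (eth_x d) + eth_y (eth_y d))\<close>.
  Centred differences are skew-adjoint on periodic grids; testing with \<open>d\<close> thus cancels the transport
  terms and gives the right-hand side a sign, whence \<open>\<Sum> d\<^sup>2 \<le> 0\<close> and the height does not change
  (\<open>implicit_advection_diffusion_unique\<close>).

  With the height unchanged the stabilisation terms vanish, the pressure gradient balances the
  Coriolis force, and the upwind transport of momentum vanishes because the velocity is constant along
  the flow; dividing by the height, which the time-step restriction makes positive, the velocity does
  not change either (\<open>aligned_equilibrium_preserved\<close>).

  All of this is symmetric in the two directions.  The flows along \<open>y\<close> and along \<open>x\<close> are both special
  cases of the single notion \<open>aligned_equilibrium\<close>.  Only here do checkerboard modes matter: a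
  vanishing centred difference must yield a constant velocity
  (\<open>periodic_two_step_imp_constant\<close>).
\<close>

section \<open>Periodic grid functions and summation by parts\<close>

definition grid_sum :: "swe \<Rightarrow> grid \<Rightarrow> real" where
  "grid_sum p z = (\<Sum>i\<in>{0..<int (nx p)}. \<Sum>j\<in>{0..<int (ny p)}. z i j)"

lemma periodic_add_mult:
  fixes f :: "int \<Rightarrow> 'a" and m i :: int
  assumes "\<And>i. f (i + m) = f i"
  shows "f (i + int k * m) = f i"
proof (induction k)
  case (Suc k)
  have "f (i + int (Suc k) * m) = f ((i + int k * m) + m)"
    by (simp add: algebra_simps)
  then show ?case
    using assms Suc by simp
qed simp

lemma periodic_mod:
  fixes f :: "int \<Rightarrow> 'a" and m i :: int
  assumes "\<And>i. f (i + m) = f i"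
  shows "f (i mod m) = f i"
proof (cases "i div m \<ge> 0")
  case True
  then show ?thesis
    using periodic_add_mult[of f m "i mod m" "nat (i div m)"] assms by simp
next
  case False
  have "i + - (i div m) * m = i mod m"
    by (simp add: minus_div_mult_eq_mod)
  then show ?thesis
    using periodic_add_mult[of f m i "nat (- (i div m))"] assms False by simp
qed

lemma sum_period_shift:
  fixes f :: "int \<Rightarrow> real"
  assumes "\<And>i. f (i + int m) = f i"
  shows "(\<Sum>i\<in>{0..<int m}. f (i - 1)) = (\<Sum>i\<in>{0..<int m}. f i)"
proof (cases m)
  case (Suc k)
  have "(\<Sum>i\<in>{0..<int m}. f (i - 1)) = (\<Sum>i\<in>{-1..<int k}. f i)"
    by (rule sum.reindex_bij_witness[where i = "\<lambda>i. i + 1" and j = "\<lambda>i. i - 1"]) (auto simp: Suc)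
  also have "{-1..<int k} = insert (-1) {0..<int k}"
    by auto
  also have "sum f \<dots> = f (-1) + sum f {0..<int k}"
    by simp
  also have "f (-1) = f (int k)"
    using assms[of "-1"] by (simp add: Suc)
  also have "f (int k) + sum f {0..<int k} = sum f (insert (int k) {0..<int k})"
    by simp
  also have "insert (int k) {0..<int k} = {0..<int m}"
    by (auto simp: Suc)
  finally show ?thesis .
qed simp

lemma grid_sum_shift_x:
  assumes "periodic_grid p z"
  shows "grid_sum p (\<lambda>i j. z (i - 1) j) = grid_sum p z"
  unfolding grid_sum_def
  by (rule sum_period_shift[where f = "\<lambda>i. \<Sum>j\<in>{0..<int (ny p)}. z i j"])
     (use assms in \<open>simp add: periodic_grid_def\<close>)

lemma grid_sum_shift_y:
  assumes "periodic_grid p z"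
  shows "grid_sum p (\<lambda>i j. z i (j - 1)) = grid_sum p z"
  unfolding grid_sum_def
  by (intro sum.cong refl sum_period_shift) (use assms in \<open>simp add: periodic_grid_def\<close>)

lemma grid_sum_add: "grid_sum p (\<lambda>i j. z i j + w i j) = grid_sum p z + grid_sum p w"
  by (simp add: grid_sum_def sum.distrib)

lemma grid_sum_diff: "grid_sum p (\<lambda>i j. z i j - w i j) = grid_sum p z - grid_sum p w"
  by (simp add: grid_sum_def sum_subtractf)

lemma grid_sum_cmult: "grid_sum p (\<lambda>i j. c * z i j) = c * grid_sum p z"
  by (simp add: grid_sum_def sum_distrib_left)

lemma grid_sum_nonneg: "(\<And>i j. 0 \<le> z i j) \<Longrightarrow> 0 \<le> grid_sum p z"
  by (simp add: grid_sum_def sum_nonneg)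

lemma periodic_grid_zero_if_sum_squares:
  assumes "periodic_grid p z" and "0 < nx p" and "0 < ny p"
    and "grid_sum p (\<lambda>i j. z i j * z i j) \<le> 0"
  shows "z i j = 0"
proof -
  have "grid_sum p (\<lambda>i j. z i j * z i j) = 0"
    using assms(4) grid_sum_nonneg[of "\<lambda>i j. z i j * z i j" p] by simp
  then have zero: "z k l = 0" if "k \<in> {0..<int (nx p)}" "l \<in> {0..<int (ny p)}" for k l
    using that unfolding grid_sum_def
    by (subst (asm) sum_nonneg_eq_0_iff) (auto simp: sum_nonneg sum_nonneg_eq_0_iff)
  have "z i j = z (i mod int (nx p)) (j mod int (ny p))"
    using periodic_mod[of "\<lambda>i. z i j" "int (nx p)" i]
      periodic_mod[of "\<lambda>j. z (i mod int (nx p)) j" "int (ny p)" j] assms(1)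
    by (simp add: periodic_grid_def)
  then show ?thesis
    using zero assms(2,3) by simp
qed

lemma eth_x_eq: "eth_x p z i j = (z (i + 1) j - z (i - 1) j) / (2 * dx p)"
  by (simp add: eth_x_def avg_x_def diff_divide_distrib add_divide_distrib)

lemma eth_y_eq: "eth_y p z i j = (z i (j + 1) - z i (j - 1)) / (2 * dy p)"
  by (simp add: eth_y_def avg_y_def diff_divide_distrib add_divide_distrib)

lemma periodic_grid_eth_x: "periodic_grid p z \<Longrightarrow> periodic_grid p (eth_x p z)"
  unfolding periodic_grid_def eth_x_eq
  by (metis add.assoc add.commute add_diff_eq diff_add_eq)

lemma periodic_grid_eth_y: "periodic_grid p z \<Longrightarrow> periodic_grid p (eth_y p z)"
  unfolding periodic_grid_def eth_y_eq
  by (metis add.assoc add.commute add_diff_eq diff_add_eq)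

text \<open>
  The sum of the two products is a difference of neighbouring values of the symmetric edge quantity
  \<open>z i j * w (i + 1) j + z (i + 1) j * w i j\<close>, so it telescopes around the torus.
\<close>

lemma eth_x_skew_adjoint:
  assumes "periodic_grid p z" and "periodic_grid p w"
  shows "grid_sum p (\<lambda>i j. z i j * eth_x p w i j) = - grid_sum p (\<lambda>i j. eth_x p z i j * w i j)"
proof -
  define S where "S i j = 1 / (2 * dx p) * (z i j * w (i + 1) j + z (i + 1) j * w i j)" for i j
  have shift: "y (i + int (nx p) + 1) j = y (i + 1) j" if "periodic_grid p y" for y i j
    using that unfolding periodic_grid_def by (metis add.assoc add.commute)
  have "periodic_grid p S"
    using assms shift[OF assms(1)] shift[OF assms(2)]
    by (simp add: S_def periodic_grid_def)
  then have "grid_sum p (\<lambda>i j. S i j - S (i - 1) j) = 0"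
    by (simp add: grid_sum_diff grid_sum_shift_x)
  moreover have "S i j - S (i - 1) j = z i j * eth_x p w i j + eth_x p z i j * w i j" for i j
    by (simp add: S_def eth_x_eq diff_divide_distrib add_divide_distrib algebra_simps)
  ultimately show ?thesis
    by (simp add: grid_sum_add)
qed

lemma eth_y_skew_adjoint:
  assumes "periodic_grid p z" and "periodic_grid p w"
  shows "grid_sum p (\<lambda>i j. z i j * eth_y p w i j) = - grid_sum p (\<lambda>i j. eth_y p z i j * w i j)"
proof -
  define S where "S i j = 1 / (2 * dy p) * (z i j * w i (j + 1) + z i (j + 1) * w i j)" for i j
  have shift: "y i (j + int (ny p) + 1) = y i (j + 1)" if "periodic_grid p y" for y i j
    using that unfolding periodic_grid_def by (metis add.assoc add.commute)
  have "periodic_grid p S"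
    using assms shift[OF assms(1)] shift[OF assms(2)]
    by (simp add: S_def periodic_grid_def)
  then have "grid_sum p (\<lambda>i j. S i j - S i (j - 1)) = 0"
    by (simp add: grid_sum_diff grid_sum_shift_y)
  moreover have "S i j - S i (j - 1) = z i j * eth_y p w i j + eth_y p z i j * w i j" for i j
    by (simp add: S_def eth_y_eq diff_divide_distrib add_divide_distrib algebra_simps)
  ultimately show ?thesis
    by (simp add: grid_sum_add)
qed

lemma eth_x_cmult:
  assumes "\<And>i j. a (i + 1) j = a i j"
  shows "eth_x p (\<lambda>i j. z i j * a i j) i j = a i j * eth_x p z i j"
  using assms[of i j] assms[of "i - 1" j] by (simp add: eth_x_eq algebra_simps)

lemma eth_y_cmult:
  assumes "\<And>i j. a i (j + 1) = a i j"
  shows "eth_y p (\<lambda>i j. z i j * a i j) i j = a i j * eth_y p z i j"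
  using assms[of i j] assms[of i "j - 1"] by (simp add: eth_y_eq algebra_simps)

text \<open>
  A coefficient that is constant in the direction of the difference commutes with it; skew-adjointness
  then equates the sum with its negative.
\<close>

lemma transport_energy_x:
  assumes "periodic_grid p z" and "periodic_grid p a" and "\<And>i j. a (i + 1) j = a i j"
  shows "grid_sum p (\<lambda>i j. z i j * (a i j * eth_x p z i j)) = 0"
proof -
  have "periodic_grid p (\<lambda>i j. z i j * a i j)"
    using assms(1,2) by (simp add: periodic_grid_def)
  from eth_x_skew_adjoint[OF assms(1) this] show ?thesis
    using assms(3) by (simp add: eth_x_cmult) (simp add: mult_ac)
qed

lemma transport_energy_y:
  assumes "periodic_grid p z" and "periodic_grid p a" and "\<And>i j. a i (j + 1) = a i j"
  shows "grid_sum p (\<lambda>i j. z i j * (a i j * eth_y p z i j)) = 0"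
proof -
  have "periodic_grid p (\<lambda>i j. z i j * a i j)"
    using assms(1,2) by (simp add: periodic_grid_def)
  from eth_y_skew_adjoint[OF assms(1) this] show ?thesis
    using assms(3) by (simp add: eth_y_cmult) (simp add: mult_ac)
qed

text \<open>
  Test the equation with \<open>d\<close>.  The transport terms contribute nothing, and the diffusion contributes
  \<open>- \<kappa>\<close> times the sum of \<open>(eth_x d)\<^sup>2 + (eth_y d)\<^sup>2\<close>.
\<close>

lemma implicit_advection_diffusion_unique:
  assumes "0 < nx p" and "0 < ny p" and "0 \<le> \<kappa>"
    and d: "periodic_grid p d" and a: "periodic_grid p a" and c: "periodic_grid p c"
    and a_const: "\<And>i j. a (i + 1) j = a i j" and c_const: "\<And>i j. c i (j + 1) = c i j"
    and eq: "\<And>i j. d i j + \<tau> * (a i j * eth_x p d i j + c i j * eth_y p d i j)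
               = \<kappa> * (eth_x p (eth_x p d) i j + eth_y p (eth_y p d) i j)"
  shows "d i j = 0"
proof -
  have "grid_sum p (\<lambda>i j. d i j * d i j)
      = grid_sum p (\<lambda>i j. \<kappa> * (d i j * eth_x p (eth_x p d) i j + d i j * eth_y p (eth_y p d) i j)
          - \<tau> * (d i j * (a i j * eth_x p d i j) + d i j * (c i j * eth_y p d i j)))"
    (is "?lhs = grid_sum p ?rhs")
  proof -
    have "d i j * d i j = ?rhs i j" for i j
      using arg_cong[OF eq[of i j], of "\<lambda>t. d i j * t"] by (simp add: algebra_simps)
    then show ?thesis
      by simp
  qed
  also have "\<dots> = \<kappa> * (grid_sum p (\<lambda>i j. d i j * eth_x p (eth_x p d) i j)
                     + grid_sum p (\<lambda>i j. d i j * eth_y p (eth_y p d) i j))"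
    by (simp add: grid_sum_diff grid_sum_cmult grid_sum_add
        transport_energy_x[OF d a a_const] transport_energy_y[OF d c c_const])
  also have "\<dots> = - \<kappa> * (grid_sum p (\<lambda>i j. eth_x p d i j * eth_x p d i j)
                       + grid_sum p (\<lambda>i j. eth_y p d i j * eth_y p d i j))"
    by (simp add: eth_x_skew_adjoint[OF d periodic_grid_eth_x[OF d]]
        eth_y_skew_adjoint[OF d periodic_grid_eth_y[OF d]] algebra_simps)
  also have "\<dots> \<le> 0"
    using assms(3) by (simp add: grid_sum_nonneg)
  finally show ?thesis
    using periodic_grid_zero_if_sum_squares d assms(1,2) by blast
qed


section \<open>Absence of checkerboard modes\<close>

text \<open>
  If the period \<open>m\<close> is odd, one step is the same as \<open>m + 1\<close> steps, which is an even number.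
\<close>

lemma periodic_two_step_imp_constant:
  fixes f :: "int \<Rightarrow> 'a"
  assumes period: "\<And>i. f (i + int m) = f i" and two: "\<And>i. f (i + 1) = f (i - 1)"
    and "even m \<longrightarrow> (\<forall>i. f (i + 1) = f i)"
  shows "f (i + 1) = f i"
proof (cases "even m")
  case False
  then obtain k where k: "m = 2 * k + 1"
    by (rule oddE)
  have step: "f (i + 2) = f i" for i
    using two[of "i + 1"] by (simp add: add.commute)
  have "f (i + 1) = f (i + 1 + int k * 2)"
    using periodic_add_mult[of f 2 "i + 1" k] step by simp
  also have "i + 1 + int k * 2 = i + int m"
    by (simp add: k)
  finally show ?thesis
    by (simp add: period)
qed (use assms in blast)

lemma eth_x_zero_imp_constant:
  assumes "periodic_grid p z" and "0 < dx p" and "\<And>i j. eth_x p z i j = 0"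
    and "no_checkerboard_x p z"
  shows "z (i + 1) j = z i j"
  using assms
  by (intro periodic_two_step_imp_constant[where f = "\<lambda>i. z i j" and m = "nx p"])
     (auto simp: periodic_grid_def eth_x_eq no_checkerboard_x_def)

lemma eth_y_zero_imp_constant:
  assumes "periodic_grid p z" and "0 < dy p" and "\<And>i j. eth_y p z i j = 0"
    and "no_checkerboard_y p z"
  shows "z i (j + 1) = z i j"
  using assms
  by (intro periodic_two_step_imp_constant[where f = "\<lambda>j. z i j" and m = "ny p"])
     (auto simp: periodic_grid_def eth_y_eq no_checkerboard_y_def)


section \<open>Preservation of grid-aligned geostrophic equilibria\<close>

lemma eth_x_phi: "eth_x p (phi p h) i j = grav p * (eth_x p h i j + eth_x p (topo_avg p) i j)"
  by (simp add: eth_x_eq phi_def diff_divide_distrib add_divide_distrib algebra_simps)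

lemma eth_y_phi: "eth_y p (phi p h) i j = grav p * (eth_y p h i j + eth_y p (topo_avg p) i j)"
  by (simp add: eth_y_eq phi_def diff_divide_distrib add_divide_distrib algebra_simps)

lemma eth_x_diff: "eth_x p (\<lambda>i j. z i j - w i j) i j = eth_x p z i j - eth_x p w i j"
  by (simp add: eth_x_eq diff_divide_distrib)

lemma eth_y_diff: "eth_y p (\<lambda>i j. z i j - w i j) i j = eth_y p z i j - eth_y p w i j"
  by (simp add: eth_y_eq diff_divide_distrib)

lemma flux_x_divergence:
  "(flux_x h u q i j - flux_x h u q (i - 1) j) / dx p
     = eth_x p (\<lambda>i j. h i j * u i j) i j - eth_x p q i j"
  by (simp add: flux_x_def eth_x_def diff_divide_distrib)

lemma flux_y_divergence:
  "(flux_y h v r i j - flux_y h v r i (j - 1)) / dy p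
     = eth_y p (\<lambda>i j. h i j * v i j) i j - eth_y p r i j"
  by (simp add: flux_y_def eth_y_def diff_divide_distrib)

text \<open>
  The common generalisation of a flow along \<open>y\<close> (\<open>u = 0\<close>) and a flow along \<open>x\<close> (\<open>v = 0\<close>).
\<close>

definition aligned_equilibrium :: "swe \<Rightarrow> grid \<Rightarrow> grid \<Rightarrow> grid \<Rightarrow> bool" where
  "aligned_equilibrium p h u v \<longleftrightarrow>
     (\<forall>i j. u (i + 1) j = u i j \<and> v i (j + 1) = v i j \<and> u i j * v i j = 0 \<and>
        u i j * eth_x p h i j = 0 \<and> v i j * eth_y p h i j = 0 \<and>
        eth_x p (phi p h) i j = coriolis p * v i j \<and>
        eth_y p (phi p h) i j = - coriolis p * u i j)"

text \<open>
  The left-hand side of the restriction is nonnegative, so the quotient of the old by the new height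
  on its right-hand side must be positive.
\<close>

lemma time_step_restriction_height_pos:
  assumes "time_step_restriction p \<eta> h0 u0 v0 h1"
    and "0 < dx p" and "0 < dy p" and "0 \<le> dt p" and "0 \<le> \<eta>"
  shows "0 < h0 i j"
proof -
  let ?M = "max (h1 i j) (h1 (i + 1) j)"
  let ?L = "dt p * (2 / dx p + 2 / dy p) *
    (max \<bar>u0 i j\<bar> \<bar>u0 (i + 1) j\<bar> + sqrt (\<eta> / ?M) * Lambda_x p h1 v0 i j)"
  have M: "0 < ?M" and "?L < min 1 (min (h0 i j) (h0 (i + 1) j) / ?M)"
    using assms(1) unfolding time_step_restriction_def by blast+
  moreover have "0 \<le> ?L"
  proof -
    have "0 \<le> Lambda_x p h1 v0 i j" and "0 \<le> sqrt (\<eta> / ?M)"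
      using divide_nonneg_pos[OF assms(5) M] by (simp_all add: Lambda_x_def le_max_iff_disj)
    then show ?thesis
      using assms(2-4) by (intro mult_nonneg_nonneg add_nonneg_nonneg) (auto simp: le_max_iff_disj)
  qed
  ultimately have "0 < min (h0 i j) (h0 (i + 1) j) / ?M"
    by linarith
  then show ?thesis
    using M by (auto simp: zero_less_divide_iff)
qed

text \<open>
  The equilibrium turns \<open>stab_q\<close> and \<open>stab_r\<close> into differences of the height increment, so the
  continuity equation is the implicit advection-diffusion equation with zero data.
\<close>

lemma aligned_equilibrium_height_preserved:
  assumes "0 < nx p" and "0 < ny p" and "0 < dt p" and "0 \<le> grav p" and "0 \<le> \<eta>"
    and h0: "periodic_grid p h0" and h1: "periodic_grid p h1"
    and u0: "periodic_grid p u0" and v0: "periodic_grid p v0"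
    and equi: "aligned_equilibrium p h0 u0 v0"
    and step: "scheme_step p (stab_q p \<eta> h1 v0) (stab_r p \<eta> h1 u0) h0 u0 v0 h1 u1 v1"
  shows "h1 = h0"
proof -
  define d where "d i j = h1 i j - h0 i j" for i j
  define \<kappa> where "\<kappa> = \<eta> * grav p * (dt p)\<^sup>2"
  have u_const: "u0 (i + 1) j = u0 i j" and v_const: "v0 i (j + 1) = v0 i j"
    and u_h: "u0 i j * eth_x p h0 i j = 0" and v_h: "v0 i j * eth_y p h0 i j = 0"
    and geo_x: "coriolis p * v0 i j = eth_x p (phi p h0) i j"
    and geo_y: "coriolis p * u0 i j = - eth_y p (phi p h0) i j" for i j
    using equi unfolding aligned_equilibrium_def by auto
  have dx_d: "eth_x p d i j = eth_x p h1 i j - eth_x p h0 i j"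
    and dy_d: "eth_y p d i j = eth_y p h1 i j - eth_y p h0 i j" for i j
    unfolding d_def by (rule eth_x_diff eth_y_diff)+
  have q: "stab_q p \<eta> h1 v0 = (\<lambda>i j. eth_x p d i j * (\<eta> * dt p * grav p))"
    by (simp add: fun_eq_iff stab_q_def geo_x eth_x_phi dx_d algebra_simps)
  have r: "stab_r p \<eta> h1 u0 = (\<lambda>i j. eth_y p d i j * (\<eta> * dt p * grav p))"
    by (simp add: fun_eq_iff stab_r_def geo_y eth_y_phi dy_d algebra_simps)
  have "d i j + dt p * (u0 i j * eth_x p d i j + v0 i j * eth_y p d i j)
      = \<kappa> * (eth_x p (eth_x p d) i j + eth_y p (eth_y p d) i j)" for i j
  proof -
    have "d i j / dt p
        + (u0 i j * eth_x p h1 i j - \<eta> * dt p * grav p * eth_x p (eth_x p d) i j)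
        + (v0 i j * eth_y p h1 i j - \<eta> * dt p * grav p * eth_y p (eth_y p d) i j) = 0"
      using step unfolding scheme_step_def Let_def flux_x_divergence flux_y_divergence
      by (simp add: d_def[symmetric] q r eth_x_cmult eth_y_cmult u_const v_const)
    moreover have "u0 i j * eth_x p h1 i j = u0 i j * eth_x p d i j"
      and "v0 i j * eth_y p h1 i j = v0 i j * eth_y p d i j"
      using u_h[of i j] v_h[of i j] by (auto simp: dx_d dy_d)
    ultimately have "d i j / dt p = \<eta> * dt p * grav p
          * (eth_x p (eth_x p d) i j + eth_y p (eth_y p d) i j)
        - (u0 i j * eth_x p d i j + v0 i j * eth_y p d i j)"
      by (simp add: algebra_simps)
    then show ?thesis
      using assms(3) by (simp add: \<kappa>_def field_simps power2_eq_square)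
  qed
  moreover have "periodic_grid p d"
    using h0 h1 by (simp add: periodic_grid_def d_def)
  moreover have "0 \<le> \<kappa>"
    using assms(4,5) by (simp add: \<kappa>_def)
  ultimately have "d i j = 0" for i j
    using implicit_advection_diffusion_unique[of p \<kappa> d u0 v0 "dt p"] assms(1,2) u0 v0
      u_const v_const by blast
  then show ?thesis
    by (simp add: d_def fun_eq_iff)
qed

text \<open>
  The mass flux in \<open>x\<close> is \<open>u0\<close> times a mean height.  It carries no \<open>v0\<close>, since the two components
  never meet, and \<open>u0\<close> is carried at a constant value, so that the divergence of its flux reduces to
  \<open>u0\<^sup>2 * eth_x p h0 = 0\<close>; likewise in \<open>y\<close>.
\<close>

lemma aligned_equilibrium_upwind_div:
  assumes "aligned_equilibrium p h0 u0 v0"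
    and q: "\<And>i j. q i j = 0" and r: "\<And>i j. r i j = 0"
  shows "upwind_div p (flux_x h0 u0 q) (flux_y h0 v0 r) u0 i j = 0"
    and "upwind_div p (flux_x h0 u0 q) (flux_y h0 v0 r) v0 i j = 0"
proof -
  let ?F = "flux_x h0 u0 q" and ?G = "flux_y h0 v0 r"
  have u_const: "u0 (i + 1) j = u0 i j" and v_const: "v0 i (j + 1) = v0 i j"
    and u_v: "u0 i j * v0 i j = 0"
    and u_h: "u0 i j * eth_x p h0 i j = 0" and v_h: "v0 i j * eth_y p h0 i j = 0" for i j
    using assms(1) unfolding aligned_equilibrium_def by auto
  have u_const': "u0 (i - 1) j = u0 i j" and v_const': "v0 i (j - 1) = v0 i j" for i j
    using u_const[of "i - 1" j] v_const[of i "j - 1"] by simp_all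
  have F: "?F i j = u0 i j * avg_x h0 i j" and G: "?G i j = v0 i j * avg_y h0 i j" for i j
    by (simp_all add: flux_x_def flux_y_def avg_x_def avg_y_def q r u_const v_const)
       (simp_all add: algebra_simps)
  have uu: "upwind_x ?F u0 i j = u0 i j" and vv: "upwind_y ?G v0 i j = v0 i j" for i j
    by (simp_all add: upwind_x_def upwind_y_def u_const v_const)
  \<comment> \<open>The upwind value may come from the neighbouring cell, where the flux velocity is the same.\<close>
  have uv: "?G i j * upwind_y ?G u0 i j = 0" for i j
    using u_v[of i j] u_v[of i "j + 1"] by (auto simp: G upwind_y_def v_const)
  have vu: "?F i j * upwind_x ?F v0 i j = 0" for i j
    using u_v[of i j] u_v[of "i + 1" j] by (auto simp: F upwind_x_def u_const)
  have "(?F i j * u0 i j - ?F (i - 1) j * u0 (i - 1) j) / dx p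
      = u0 i j * (u0 i j * eth_x p h0 i j)"
    by (simp add: F u_const' eth_x_def algebra_simps diff_divide_distrib)
  then show "upwind_div p ?F ?G u0 i j = 0"
    by (simp add: upwind_div_def uu uv u_h)
  have "(?G i j * v0 i j - ?G i (j - 1) * v0 i (j - 1)) / dy p
      = v0 i j * (v0 i j * eth_y p h0 i j)"
    by (simp add: G v_const' eth_y_def algebra_simps diff_divide_distrib)
  then show "upwind_div p ?F ?G v0 i j = 0"
    by (simp add: upwind_div_def vv vu v_h)
qed

lemma aligned_equilibrium_preserved:
  assumes "0 < nx p" and "0 < ny p" and "0 < dx p" and "0 < dy p"
    and "0 < dt p" and "0 \<le> grav p" and "0 \<le> \<eta>"
    and "periodic_grid p h0" and "periodic_grid p h1"
    and "periodic_grid p u0" and "periodic_grid p v0"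
    and equi: "aligned_equilibrium p h0 u0 v0"
    and step: "scheme_step p (stab_q p \<eta> h1 v0) (stab_r p \<eta> h1 u0) h0 u0 v0 h1 u1 v1"
    and restr: "time_step_restriction p \<eta> h0 u0 v0 h1"
  shows "h1 = h0 \<and> u1 = u0 \<and> v1 = v0"
proof -
  have h: "h1 = h0"
    using aligned_equilibrium_height_preserved assms by blast
  have geo_x: "eth_x p (phi p h0) i j = coriolis p * v0 i j"
    and geo_y: "eth_y p (phi p h0) i j = - coriolis p * u0 i j" for i j
    using equi unfolding aligned_equilibrium_def by auto
  have q: "stab_q p \<eta> h1 v0 i j = 0" and r: "stab_r p \<eta> h1 u0 i j = 0" for i j
    by (simp_all add: stab_q_def stab_r_def h geo_x geo_y)
  have div: "upwind_div p (flux_x h1 u0 (stab_q p \<eta> h1 v0)) (flux_y h1 v0 (stab_r p \<eta> h1 u0)) w i j = 0"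
    if "w = u0 \<or> w = v0" for w i j
    using aligned_equilibrium_upwind_div[OF equi, of "stab_q p \<eta> h1 v0" "stab_r p \<eta> h1 u0" i j]
      q r that by (auto simp: h)
  have "u1 i j = u0 i j \<and> v1 i j = v0 i j" for i j
  proof -
    have "(h0 i j * u1 i j - h0 i j * u0 i j) / dt p = 0"
      and "(h0 i j * v1 i j - h0 i j * v0 i j) / dt p = 0"
      using step unfolding scheme_step_def Let_def
      by (simp_all add: div q r geo_x geo_y, simp_all add: h geo_x geo_y)
    moreover have "0 < h0 i j"
      using time_step_restriction_height_pos[OF restr] assms(3-7) by simp
    ultimately show ?thesis
      using assms(5) by simp
  qed
  with h show ?thesis
    by (simp add: fun_eq_iff)
qed


section \<open>Geostrophic equilibria along the coordinate directions\<close>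

theorem theorem1p8:
  fixes p :: swe and \<eta> \<delta>0 T :: real and N n :: nat and h u v :: "nat \<Rightarrow> grid"
  assumes "0 < nx p" and "0 < ny p" and "0 < dx p" and "0 < dy p"
    and "0 < \<delta>0" and "mesh_size p \<le> \<delta>0"
    and "0 < T" and "dt p = T / real N" and "n < N"
    and "0 < grav p"
    and "Wkinf_torus 2 (real (nx p) * dx p) (real (ny p) * dy p) (topo p)"
    and "0 < \<eta>"
    and "\<And>k. k \<in> {n, Suc n} \<Longrightarrow>
           periodic_grid p (h k) \<and> periodic_grid p (u k) \<and> periodic_grid p (v k)"
    and "scheme_step p (stab_q p \<eta> (h (Suc n)) (v n)) (stab_r p \<eta> (h (Suc n)) (u n))
           (h n) (u n) (v n) (h (Suc n)) (u (Suc n)) (v (Suc n))"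
    and "time_step_restriction p \<eta> (h n) (u n) (v n) (h (Suc n))"
  shows
    "((\<forall>i j. u n i j = 0 \<and> eth_y p (h n) i j = 0 \<and> eth_y p (topo_avg p) i j = 0 \<and>
             eth_y p (v n) i j = 0 \<and> eth_x p (phi p (h n)) i j - coriolis p * v n i j = 0)
        \<and> no_checkerboard_y p (v n)
      \<longrightarrow>
      (\<forall>i j. (h (Suc n) i j, u (Suc n) i j, v (Suc n) i j) = (h n i j, u n i j, v n i j) \<and>
             u (Suc n) i j = 0 \<and> eth_y p (h (Suc n)) i j = 0 \<and> eth_y p (v (Suc n)) i j = 0 \<and>
             eth_x p (phi p (h (Suc n))) i j - coriolis p * v (Suc n) i j = 0))
     \<and>
     ((\<forall>i j. v n i j = 0 \<and> eth_x p (h n) i j = 0 \<and> eth_x p (topo_avg p) i j = 0 \<and>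
             eth_x p (u n) i j = 0 \<and> eth_y p (phi p (h n)) i j + coriolis p * u n i j = 0)
        \<and> no_checkerboard_x p (u n)
      \<longrightarrow>
      (\<forall>i j. (h (Suc n) i j, u (Suc n) i j, v (Suc n) i j) = (h n i j, u n i j, v n i j) \<and>
             v (Suc n) i j = 0 \<and> eth_x p (h (Suc n)) i j = 0 \<and> eth_x p (u (Suc n)) i j = 0 \<and>
             eth_y p (phi p (h (Suc n))) i j + coriolis p * u (Suc n) i j = 0))"
proof -
  have dt: "0 < dt p"
    using assms(7-9) by simp
  have per: "periodic_grid p (h n)" "periodic_grid p (h (Suc n))"
    "periodic_grid p (u n)" "periodic_grid p (v n)"
    using assms(13) by auto
  have preserved: "h (Suc n) = h n \<and> u (Suc n) = u n \<and> v (Suc n) = v n"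
    if "aligned_equilibrium p (h n) (u n) (v n)"
    using aligned_equilibrium_preserved[OF assms(1-4) dt _ _ per that assms(14,15)] assms(10,12)
    by simp
  show ?thesis
  proof (intro conjI impI, goal_cases)
    case 1
    then have eq: "u n i j = 0" "eth_y p (h n) i j = 0" "eth_y p (topo_avg p) i j = 0"
      "eth_y p (v n) i j = 0" "eth_x p (phi p (h n)) i j = coriolis p * v n i j" for i j
      by simp_all
    have "aligned_equilibrium p (h n) (u n) (v n)"
      using eth_y_zero_imp_constant[OF per(4) assms(4) eq(4)] 1
      by (simp add: aligned_equilibrium_def eq eth_y_phi)
    then show ?case
      using preserved eq by simp
  next
    case 2
    then have eq: "v n i j = 0" "eth_x p (h n) i j = 0" "eth_x p (topo_avg p) i j = 0"
      "eth_x p (u n) i j = 0" "eth_y p (phi p (h n)) i j = - coriolis p * u n i j" for i j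
      by (simp_all add: eq_neg_iff_add_eq_0)
    have "aligned_equilibrium p (h n) (u n) (v n)"
      using eth_x_zero_imp_constant[OF per(3) assms(3) eq(4)] 2
      by (simp add: aligned_equilibrium_def eq eth_x_phi)
    then show ?case
      using preserved eq by simp
  qed
qed

end
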